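(* Let $\mathcal{M}\in S(d,\kappa,\epsilon_0)$, let $p\in[1,\infty)$, and let $f$ be a bounded probability density function on $\mathcal{M}$ with $f_{\min}=\min_{\mathcal{M}} f>0$ that is $F$-Lipschitz with respect to geodesic distance, i.e. $|f(x)-f(y)|\le F\,\mathscr{D}(x,y)$ for all $x,y\in\mathcal{M}$. Let $\epsilon>0$ and set \[\rho=\max_{x\in\mathcal{M}}\rho_{x,\epsilon},\qquad C_1=\frac{F\left(\rho^{\frac{p-1}{d}}+1\right)(p-1)}{f_{\min}^{1+\frac{p-1}{pd}}\,pd},\qquad C_2=\frac{\kappa}{f_{\min}^{\frac{p-1}{pd}}\,p}.\] Then for all $x,y\in\mathcal{M}$ such that $\mathscr{D}(x,y)\le\epsilon_0$ and $\|x-y\|\le\epsilon$, \[\left|\mathcal{L}_p(x,y)-\mathscr{D}_{f,\mathrm{Euc}}^{1/p}(x,y)\right|\le C_1\epsilon^{1+\frac1p}+C_2\epsilon^{2+\frac1p}+O\!\left(\epsilon^{3+\frac1p}\right).\]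
   Context: $\|\cdot\|$ is the Euclidean norm. $S(d,\kappa,\epsilon_0)$ (with $\kappa\ge 0$, $\epsilon_0>0$) is the class of isometrically embedded Riemannian manifolds $\mathcal{M}\subset\mathbb{R}^D$ (metric $g$ induced by the Euclidean metric) that are compact of dimension $d$, have $\mathrm{vol}(\mathcal{M})=1$, and satisfy $\mathscr{D}(x,y)\le\|x-y\|(1+\kappa\|x-y\|^2)$ for all $x,y\in\mathcal{M}$ with $\mathscr{D}(x,y)\le\epsilon_0$, where $\mathscr{D}$ is geodesic distance on $\mathcal{M}$. The continuum $p$-weighted shortest path distance is \[\mathcal{L}_p(x,y)=\left(\inf_\gamma\int_0^1\frac{1}{f(\gamma(t))^{\frac{p-1}{d}}}\sqrt{g(\gamma'(t),\gamma'(t))}\,dt\right)^{1/p},\] the infimum being over $C^1$ paths $\gamma:[0,1]\to\mathcal{M}$ with $\gamma(0)=x$, $\gamma(1)=y$; $\mathcal{L}_p^p$ denotes its $p$-th power. The density-based stretch of Euclidean distance is $\mathscr{D}_{f,\mathrm{Euc}}(x,y)=\dfrac{\|x-y\|}{(f(x)f(y))^{\frac{p-1}{2d}}}$. For a metric $\delta$, $B_\delta(x,r)=\{y:\delta(x,y)\le r\}$. Local quantities: \[f_{\min}(x,\epsilon)=\min\{f(y):y\in B_{\mathscr{D}}(x,\epsilon(1+\kappa\epsilon^2))\},\] \[f_{\max}(x,\epsilon)=\max\{f(y):y\in B_{\mathcal{L}_p^p}(x,\epsilon(1+\kappa\epsilon^2)/f_{\min}(x,\epsilon)^{\frac{p-1}{d}})\},\]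 and $\rho_{x,\epsilon}=f_{\max}(x,\epsilon)/f_{\min}(x,\epsilon)$. The $O(\cdot)$ term is as $\epsilon\to0^+$, with implied constant independent of $x,y$ and $\epsilon$ (it may depend on $\mathcal{M},f,p$). *)

theory Defs
  imports "HOL-Analysis.Analysis" "HOL-Library.Landau_Symbols"
begin

text \<open>
  Meant for open \<open>S\<close>: \<open>Ck_on k f S\<close> says that \<open>f\<close> is \<open>k\<close> times continuously differentiable on
  \<open>S\<close>. Each directional derivative is again a function of the same type, which makes the
  recursion over \<open>k\<close> possible.
\<close>

primrec Ck_on :: "nat \<Rightarrow> ('a::euclidean_space \<Rightarrow> 'b::real_normed_vector) \<Rightarrow> 'a set \<Rightarrow> bool" where
  "Ck_on 0 f S \<longleftrightarrow> continuous_on S f"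
| "Ck_on (Suc k) f S \<longleftrightarrow>
     (\<forall>x\<in>S. f differentiable (at x)) \<and> (\<forall>v. Ck_on k (\<lambda>x. frechet_derivative f (at x) v) S)"

definition smooth_on :: "('a::euclidean_space \<Rightarrow> 'b::real_normed_vector) \<Rightarrow> 'a set \<Rightarrow> bool" where
  "smooth_on f S \<longleftrightarrow> (\<forall>k. Ck_on k f S)"

definition local_param ::
  "(real^'n) set \<Rightarrow> (real^'d) set \<Rightarrow> (real^'d \<Rightarrow> real^'n) \<Rightarrow> bool" where
  "local_param M V \<psi> \<longleftrightarrow>
     open V \<and> smooth_on \<psi> V \<and> (\<forall>u\<in>V. inj (frechet_derivative \<psi> (at u))) \<and>
     openin (top_of_set M) (\<psi> ` V) \<and> (\<exists>\<phi>. homeomorphism V (\<psi> ` V) \<psi> \<phi>)"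

text \<open>
  Smooth embedded submanifold without boundary; its dimension \<open>CARD('d)\<close> is carried by the
  type argument.
\<close>

definition embedded_submanifold :: "'d::finite itself \<Rightarrow> (real^'n) set \<Rightarrow> bool" where
  "embedded_submanifold T M \<longleftrightarrow>
     (\<forall>x\<in>M. \<exists>(V :: (real^'d) set) \<psi>. local_param M V \<psi> \<and> x \<in> \<psi> ` V)"

text \<open>The matrix, in the coordinates \<open>\<psi>\<close>, of the metric induced by the Euclidean one.\<close>

definition metric_matrix :: "(real^'d \<Rightarrow> real^'n) \<Rightarrow> real^'d \<Rightarrow> real^'d^'d" where
  "metric_matrix \<psi> u =
     (\<chi> i j. frechet_derivative \<psi> (at u) (axis i 1) \<bullet> frechet_derivative \<psi> (at u) (axis j 1))"

text \<open>
  The Riemannian volume is the unique Borel measure on \<open>M\<close> that is given by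
  \<open>sqrt (det g) du\<close> in every local parametrization. Existence and uniqueness for embedded
  submanifolds are classical.
\<close>

definition riemannian_volume :: "'d::finite itself \<Rightarrow> (real^'n) set \<Rightarrow> (real^'n) measure" where
  "riemannian_volume T M = (THE \<mu>.
     sets \<mu> = sets (restrict_space borel M) \<and>
     (\<forall>(V :: (real^'d) set) \<psi> E. local_param M V \<psi> \<and> E \<in> sets borel \<and> E \<subseteq> V \<longrightarrow>
        emeasure \<mu> (\<psi> ` E) = (\<integral>\<^sup>+ u\<in>E. ennreal (sqrt (det (metric_matrix \<psi> u))) \<partial>lborel)))"

text \<open>
  A path is a function on all of \<open>real\<close> whose values outside \<open>{0..1}\<close> are irrelevant, so the
  two-sided derivatives at the end points in \<open>C1_differentiable_on\<close> are no restriction: a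
  \<open>C\<^sup>1\<close> path on \<open>{0..1}\<close> extends affinely.
\<close>

definition C1_paths :: "(real^'n) set \<Rightarrow> real^'n \<Rightarrow> real^'n \<Rightarrow> (real \<Rightarrow> real^'n) set" where
  "C1_paths M x y =
     {\<gamma>. \<gamma> C1_differentiable_on {0..1} \<and> \<gamma> ` {0..1} \<subseteq> M \<and> \<gamma> 0 = x \<and> \<gamma> 1 = y}"

text \<open>
  Distances are extended-valued: connectedness of \<open>M\<close> is not assumed, and the infimum over the
  empty set of paths is \<open>\<infinity>\<close>.
\<close>

definition geod_dist :: "(real^'n) set \<Rightarrow> real^'n \<Rightarrow> real^'n \<Rightarrow> ennreal" where
  "geod_dist M x y =
     (INF \<gamma>\<in>C1_paths M x y. \<integral>\<^sup>+ t\<in>{0..1}. ennreal (norm (vector_derivative \<gamma> (at t))) \<partial>lborel)"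

text \<open>\<open>Lpp\<close> is the \<open>p\<close>-th power of the \<open>p\<close>-weighted shortest path distance \<open>Lp\<close>.\<close>

definition Lpp ::
  "nat \<Rightarrow> real \<Rightarrow> (real^'n \<Rightarrow> real) \<Rightarrow> (real^'n) set \<Rightarrow> real^'n \<Rightarrow> real^'n \<Rightarrow> ennreal" where
  "Lpp d p f M x y =
     (INF \<gamma>\<in>C1_paths M x y. \<integral>\<^sup>+ t\<in>{0..1}.
        ennreal (1 / f (\<gamma> t) powr ((p - 1) / real d) * norm (vector_derivative \<gamma> (at t))) \<partial>lborel)"

text \<open>Only meaningful where \<open>Lpp\<close> is finite, that is, if some path joins \<open>x\<close> and \<open>y\<close>.\<close>

definition Lp ::
  "nat \<Rightarrow> real \<Rightarrow> (real^'n \<Rightarrow> real) \<Rightarrow> (real^'n) set \<Rightarrow> real^'n \<Rightarrow> real^'n \<Rightarrow> real" where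
  "Lp d p f M x y = enn2real (Lpp d p f M x y) powr (1 / p)"

definition stretch_dist ::
  "nat \<Rightarrow> real \<Rightarrow> (real^'n \<Rightarrow> real) \<Rightarrow> real^'n \<Rightarrow> real^'n \<Rightarrow> real" where
  "stretch_dist d p f x y = norm (x - y) / (f x * f y) powr ((p - 1) / (2 * real d))"

definition manifold_class :: "'d::finite itself \<Rightarrow> real \<Rightarrow> real \<Rightarrow> (real^'n) set set" where
  "manifold_class T \<kappa> \<epsilon>\<^sub>0 = {M.
     compact M \<and> embedded_submanifold T M \<and> emeasure (riemannian_volume T M) M = 1 \<and>
     (\<forall>x\<in>M. \<forall>y\<in>M. geod_dist M x y \<le> ennreal \<epsilon>\<^sub>0 \<longrightarrow>
        geod_dist M x y \<le> ennreal (norm (x - y) * (1 + \<kappa> * (norm (x - y))\<^sup>2)))}"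

definition prob_density_on ::
  "'d::finite itself \<Rightarrow> (real^'n) set \<Rightarrow> (real^'n \<Rightarrow> real) \<Rightarrow> bool" where
  "prob_density_on T M f \<longleftrightarrow>
     f \<in> borel_measurable (riemannian_volume T M) \<and> (\<forall>x\<in>M. 0 \<le> f x) \<and>
     (\<integral>\<^sup>+ x. ennreal (f x) \<partial>(riemannian_volume T M)) = 1"

definition geod_lipschitz :: "real \<Rightarrow> (real^'n) set \<Rightarrow> (real^'n \<Rightarrow> real) \<Rightarrow> bool" where
  "geod_lipschitz F M f \<longleftrightarrow> 0 \<le> F \<and>
     (\<forall>x\<in>M. \<forall>y\<in>M. geod_dist M x y < \<infinity> \<longrightarrow> \<bar>f x - f y\<bar> \<le> F * enn2real (geod_dist M x y))"

definition dist_ball ::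
  "(real^'n) set \<Rightarrow> (real^'n \<Rightarrow> real^'n \<Rightarrow> ennreal) \<Rightarrow> real^'n \<Rightarrow> real \<Rightarrow> (real^'n) set" where
  "dist_ball M \<delta> x r = {y\<in>M. \<delta> x y \<le> ennreal r}"

text \<open>
  Minima and maxima of \<open>f\<close> are written as infima and suprema; they are attained for continuous
  \<open>f\<close> on a compact manifold.
\<close>

definition f_min_loc ::
  "real \<Rightarrow> (real^'n \<Rightarrow> real) \<Rightarrow> (real^'n) set \<Rightarrow> real^'n \<Rightarrow> real \<Rightarrow> real" where
  "f_min_loc \<kappa> f M x \<epsilon> = (INF y\<in>dist_ball M (geod_dist M) x (\<epsilon> * (1 + \<kappa> * \<epsilon>\<^sup>2)). f y)"

definition f_max_loc ::
  "nat \<Rightarrow> real \<Rightarrow> real \<Rightarrow> (real^'n \<Rightarrow> real) \<Rightarrow> (real^'n) set \<Rightarrow> real^'n \<Rightarrow> real \<Rightarrow> real" where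
  "f_max_loc d p \<kappa> f M x \<epsilon> =
     (SUP y\<in>dist_ball M (Lpp d p f M) x
        (\<epsilon> * (1 + \<kappa> * \<epsilon>\<^sup>2) / f_min_loc \<kappa> f M x \<epsilon> powr ((p - 1) / real d)). f y)"

definition rho_loc ::
  "nat \<Rightarrow> real \<Rightarrow> real \<Rightarrow> (real^'n \<Rightarrow> real) \<Rightarrow> (real^'n) set \<Rightarrow> real^'n \<Rightarrow> real \<Rightarrow> real" where
  "rho_loc d p \<kappa> f M x \<epsilon> = f_max_loc d p \<kappa> f M x \<epsilon> / f_min_loc \<kappa> f M x \<epsilon>"

end

theory Submission
  imports Defs
begin

text \<open>
  Write \<open>e\<close> for the Euclidean distance of \<open>x\<close> and \<open>y\<close>, \<open>a = (p - 1) / d\<close>, \<open>B = a * F / f_min\<close> and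
  \<open>G = (f x * f y) powr (- a / 2)\<close>, so that the stretch distance is \<open>e * G\<close>. On a path of length \<open>l\<close>
  from \<open>x\<close> to \<open>y\<close> the Lipschitz bound on \<open>ln f\<close> puts the weight between \<open>exp (- B * l) * G\<close> and
  \<open>exp (B * l) * G\<close>. Letting \<open>l\<close> tend to the geodesic distance, which is at most
  \<open>e * (1 + \<kappa> * e\<^sup>2)\<close>, gives the upper bound. The lower bound follows from \<open>e \<le> l\<close> because
  \<open>l * exp (- B * l)\<close> is increasing for \<open>B * l \<le> 1\<close>. Both estimates have first-order coefficient at
  most \<open>2 * B / p\<close> relative to \<open>(e * G) powr (1 / p)\<close>, and \<open>C\<^sub>1\<close> allows for that since \<open>\<rho> \<ge> 1\<close>.
  When \<open>e\<close> is not small, the bounded error is absorbed into the remainder.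
\<close>

section \<open>Path length and geodesic distance\<close>

definition path_length :: "(real \<Rightarrow> real^'n) \<Rightarrow> ennreal" where
  "path_length \<gamma> = (\<integral>\<^sup>+ t\<in>{0..1}. ennreal (norm (vector_derivative \<gamma> (at t))) \<partial>lborel)"

lemma geod_dist_eq_Inf_path_length:
  "geod_dist M x y = (INF \<gamma>\<in>C1_paths M x y. path_length \<gamma>)"
  by (simp add: geod_dist_def path_length_def)

lemma C1_paths_has_vector_derivative:
  assumes "\<gamma> \<in> C1_paths M x y" "t \<in> {0..1}"
  shows "(\<gamma> has_vector_derivative vector_derivative \<gamma> (at t)) (at t)"
  using assms unfolding C1_paths_def C1_differentiable_on_eq
  by (auto simp: vector_derivative_works)

lemma C1_paths_continuous_on_vector_derivative:
  assumes "\<gamma> \<in> C1_paths M x y"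
  shows "continuous_on {0..1} (\<lambda>t. vector_derivative \<gamma> (at t))"
  using assms unfolding C1_paths_def C1_differentiable_on_eq by auto

text \<open>The derivative is controlled only on \<open>{0..1}\<close>, so measurability on the
  whole line is obtained after cutting off by an indicator. The general interval
  \<open>{u..v}\<close> serves the passage to subpaths.\<close>

lemma C1_paths_speed_measurable:
  assumes "\<gamma> \<in> C1_paths M x y" "0 \<le> u" "v \<le> 1"
  shows "(\<lambda>t. ennreal (norm (vector_derivative \<gamma> (at t))) * indicator {u..v} t)
    \<in> borel_measurable borel"
proof -
  have "continuous_on {u..v} (\<lambda>t. norm (vector_derivative \<gamma> (at t)))"
    using assms C1_paths_continuous_on_vector_derivative[OF assms(1)]
    by (intro continuous_on_norm) (auto elim: continuous_on_subset)
  then have "(\<lambda>t. indicator {u..v} t *\<^sub>R norm (vector_derivative \<gamma> (at t))) \<in> borel_measurable borel"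
    by (intro borel_measurable_continuous_on_indicator) auto
  then have "(\<lambda>t. ennreal (indicator {u..v} t *\<^sub>R norm (vector_derivative \<gamma> (at t))))
      \<in> borel_measurable borel"
    by (rule measurable_compose[OF _ measurable_ennreal])
  moreover have "(\<lambda>t. ennreal (indicator {u..v} t *\<^sub>R norm (vector_derivative \<gamma> (at t))))
     = (\<lambda>t. ennreal (norm (vector_derivative \<gamma> (at t))) * indicator {u..v} t)"
    by (auto simp: indicator_def)
  ultimately show ?thesis by (simp only:)
qed

text \<open>The speed is continuous on a compact interval, so the extended-valued integral is finite
  and agrees with the gauge integral, where the fundamental theorem of calculus is
  available.\<close>

lemma path_length_eq_integral:
  assumes "\<gamma> \<in> C1_paths M x y"
  shows "path_length \<gamma> = ennreal (integral {0..1} (\<lambda>t. norm (vector_derivative \<gamma> (at t))))"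
proof -
  have "(\<lambda>t. norm (vector_derivative \<gamma> (at t))) integrable_on {0..1}"
    using C1_paths_continuous_on_vector_derivative[OF assms]
    by (intro integrable_continuous_real continuous_on_norm)
  then have *: "((\<lambda>t. norm (vector_derivative \<gamma> (at t))) has_integral
      integral {0..1} (\<lambda>t. norm (vector_derivative \<gamma> (at t)))) {0..1}"
    by (rule integrable_integral)
  have meas: "(\<lambda>t. indicator {0..1::real} t * norm (vector_derivative \<gamma> (at t))) \<in> borel_measurable borel"
    using borel_measurable_continuous_on_indicator[OF _ continuous_on_norm[OF C1_paths_continuous_on_vector_derivative[OF assms]]]
    by simp
  have "((\<lambda>t. if t \<in> {0..1} then norm (vector_derivative \<gamma> (at t)) else 0) has_integral
      integral {0..1} (\<lambda>t. norm (vector_derivative \<gamma> (at t)))) UNIV"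
    using * by (rule has_integral_restrict_UNIV[THEN iffD2])
  then have "((\<lambda>t. indicator {0..1::real} t * norm (vector_derivative \<gamma> (at t))) has_integral
      integral {0..1} (\<lambda>t. norm (vector_derivative \<gamma> (at t)))) UNIV"
    by (rule has_integral_eq[rotated]) (simp add: indicator_def)
  then have "(\<integral>\<^sup>+ t. ennreal (indicator {0..1::real} t * norm (vector_derivative \<gamma> (at t))) \<partial>lborel)
      = ennreal (integral {0..1} (\<lambda>t. norm (vector_derivative \<gamma> (at t))))"
    using meas by (intro nn_integral_has_integral_lborel) auto
  moreover have "path_length \<gamma> =
      (\<integral>\<^sup>+ t. ennreal (indicator {0..1::real} t * norm (vector_derivative \<gamma> (at t))) \<partial>lborel)"
    unfolding path_length_def by (intro nn_integral_cong) (auto simp: indicator_def)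
  ultimately show ?thesis by simp
qed

lemma path_length_real:
  assumes "\<gamma> \<in> C1_paths M x y"
  obtains l where "path_length \<gamma> = ennreal l" "0 \<le> l"
proof
  show "0 \<le> integral {0..1} (\<lambda>t. norm (vector_derivative \<gamma> (at t)))"
    using C1_paths_continuous_on_vector_derivative[OF assms]
    by (intro integral_nonneg integrable_continuous_real continuous_on_norm) auto
qed (rule path_length_eq_integral[OF assms])

text \<open>By the fundamental theorem of calculus \<open>y - x\<close> is the integral of the
  velocity, and the norm of an integral is at most the integral of the norm.\<close>

lemma norm_diff_le_path_length:
  assumes "\<gamma> \<in> C1_paths M x y"
  shows "ennreal (norm (x - y)) \<le> path_length \<gamma>"
proof -
  have int: "((\<lambda>t. vector_derivative \<gamma> (at t)) has_integral (\<gamma> 1 - \<gamma> 0)) {0..1}"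
    using C1_paths_has_vector_derivative[OF assms]
    by (intro fundamental_theorem_of_calculus) (auto intro: has_vector_derivative_at_within)
  have "(\<lambda>t. norm (vector_derivative \<gamma> (at t))) integrable_on {0..1}"
    using C1_paths_continuous_on_vector_derivative[OF assms]
    by (intro integrable_continuous_real continuous_on_norm)
  then have "norm (integral {0..1} (\<lambda>t. vector_derivative \<gamma> (at t)))
      \<le> integral {0..1} (\<lambda>t. norm (vector_derivative \<gamma> (at t)))"
    using int by (intro integral_norm_bound_integral) auto
  moreover have "integral {0..1} (\<lambda>t. vector_derivative \<gamma> (at t)) = y - x"
    using integral_unique[OF int] assms by (simp add: C1_paths_def)
  ultimately show ?thesis
    unfolding path_length_eq_integral[OF assms] by (simp add: norm_minus_commute ennreal_leI)
qed

lemma norm_diff_le_geod_dist: "ennreal (norm (x - y)) \<le> geod_dist M x y"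
  unfolding geod_dist_eq_Inf_path_length by (intro INF_greatest norm_diff_le_path_length)

lemma const_path:
  assumes "x \<in> M"
  shows "(\<lambda>_. x) \<in> C1_paths M x x"
  using assms by (auto simp: C1_paths_def)

lemma subpath_affine_in_C1_paths:
  assumes "\<gamma> \<in> C1_paths M x y" "0 \<le> u" "u \<le> v" "v \<le> 1"
  shows "(\<lambda>s. \<gamma> (u + (v - u) * s)) \<in> C1_paths M (\<gamma> u) (\<gamma> v)"
    and "\<And>s. s \<in> {0..1} \<Longrightarrow> vector_derivative (\<lambda>s. \<gamma> (u + (v - u) * s)) (at s)
      = (v - u) *\<^sub>R vector_derivative \<gamma> (at (u + (v - u) * s))"
proof -
  have rng: "u + (v - u) * s \<in> {0..1}" if "s \<in> {0..1}" for s
  proof -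
    have "(v - u) * s \<le> v - u" using that assms mult_left_mono[of s 1 "v - u"] by simp
    moreover have "0 \<le> (v - u) * s" using that assms by auto
    ultimately show ?thesis using assms unfolding atLeastAtMost_iff by (intro conjI) linarith+
  qed
  have deriv: "((\<lambda>s. \<gamma> (u + (v - u) * s)) has_vector_derivative
      (v - u) *\<^sub>R vector_derivative \<gamma> (at (u + (v - u) * s))) (at s)" if "s \<in> {0..1}" for s
  proof -
    have "((\<lambda>s. u + (v - u) * s) has_vector_derivative (v - u)) (at s)"
      by (auto intro!: derivative_eq_intros simp: has_real_derivative_iff_has_vector_derivative[symmetric])
    from vector_diff_chain_at[OF this C1_paths_has_vector_derivative[OF assms(1) rng[OF that]]]
    show ?thesis by (simp add: o_def)
  qed
  have "continuous_on {0..1} (\<lambda>s. (v - u) *\<^sub>R vector_derivative \<gamma> (at (u + (v - u) * s)))"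
  proof (rule continuous_on_scaleR[OF continuous_on_const])
    show "continuous_on {0..1} (\<lambda>s. vector_derivative \<gamma> (at (u + (v - u) * s)))"
    proof (rule continuous_on_compose2[OF C1_paths_continuous_on_vector_derivative[OF assms(1)],
            of "{0..1}" "\<lambda>s. u + (v - u) * s"])
      show "(\<lambda>s. u + (v - u) * s) ` {0..1} \<subseteq> {0..1}" using rng by blast
    qed (intro continuous_intros)
  qed
  then have "(\<lambda>s. \<gamma> (u + (v - u) * s)) C1_differentiable_on {0..1}"
    unfolding C1_differentiable_on_def using deriv
    by (intro exI[of _ "\<lambda>s. (v - u) *\<^sub>R vector_derivative \<gamma> (at (u + (v - u) * s))"] conjI ballI)
  moreover have "\<gamma> (u + (v - u) * s) \<in> M" if "s \<in> {0..1}" for s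
    using assms(1) rng[OF that] unfolding C1_paths_def by blast
  ultimately show "(\<lambda>s. \<gamma> (u + (v - u) * s)) \<in> C1_paths M (\<gamma> u) (\<gamma> v)"
    by (simp add: C1_paths_def image_subset_iff)
  show "vector_derivative (\<lambda>s. \<gamma> (u + (v - u) * s)) (at s)
      = (v - u) *\<^sub>R vector_derivative \<gamma> (at (u + (v - u) * s))" if "s \<in> {0..1}" for s
    using deriv[OF that] by (rule vector_derivative_at)
qed

text \<open>The affinely reparametrized piece over \<open>{u..v}\<close> is a competitor in the
  infimum and is no longer than the whole path. With \<open>u = 0\<close> or \<open>v = 1\<close>
  this places every point of the path within its length of both end points, which is how the
  Lipschitz condition is brought in.\<close>

lemma geod_dist_le_path_length:
  assumes "\<gamma> \<in> C1_paths M x y" "0 \<le> u" "u \<le> v" "v \<le> 1"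
  shows "geod_dist M (\<gamma> u) (\<gamma> v) \<le> path_length \<gamma>"
proof -
  let ?\<sigma> = "\<lambda>s. \<gamma> (u + (v - u) * s)"
  let ?g = "\<lambda>t. ennreal (norm (vector_derivative \<gamma> (at t))) * indicator {u..v} t"
  have "path_length ?\<sigma> \<le> path_length \<gamma>"
  \<comment> \<open>The substitution \<open>t = u + (v - u) * s\<close> needs a nonzero factor; for
    \<open>u = v\<close> the piece is a constant path.\<close>
  proof (cases "u = v")
    case True
    have "path_length ?\<sigma> = 0"
      unfolding path_length_def using True by simp
    then show ?thesis by simp
  next
    case False
    then have c: "0 < v - u" using assms by simp
    \<comment> \<open>This turns the indicator of \<open>{0..1}\<close> in \<open>s\<close> into
      that of \<open>{u..v}\<close> in \<open>t\<close>, so that the substitution can be made in an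
      integral over the whole line.\<close>
    have iff: "u + (v - u) * s \<in> {u..v} \<longleftrightarrow> s \<in> {0..1}" for s
    proof -
      have "0 \<le> (v - u) * s \<longleftrightarrow> 0 \<le> s" using c by (simp add: zero_le_mult_iff)
      moreover have "(v - u) * s \<le> (v - u) * 1 \<longleftrightarrow> s \<le> 1"
        using c by (subst mult_le_cancel_left_pos) auto
      ultimately show ?thesis by auto
    qed
    have "path_length ?\<sigma> = (\<integral>\<^sup>+ s. ennreal (v - u) * ?g (u + (v - u) * s) \<partial>lborel)"
      unfolding path_length_def
    proof (intro nn_integral_cong)
      fix s :: real
      show "ennreal (norm (vector_derivative ?\<sigma> (at s))) * indicator {0..1} s =
          ennreal (v - u) * ?g (u + (v - u) * s)"
      proof (cases "s \<in> {0..1}")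
        case True
        have "ennreal (norm (vector_derivative ?\<sigma> (at s)))
            = ennreal (v - u) * ennreal (norm (vector_derivative \<gamma> (at (u + (v - u) * s))))"
          unfolding subpath_affine_in_C1_paths(2)[OF assms True]
          using c by (simp only: norm_scaleR abs_of_pos ennreal_mult norm_ge_zero less_imp_le)
        then show ?thesis using iff[of s] True by (simp add: indicator_def)
      next
        case False
        then have "u + (v - u) * s \<notin> {u..v}" using iff[of s] by blast
        with False show ?thesis by (simp only: indicator_simps mult_zero_right not_False_eq_True)
      qed
    qed
    also have "\<dots> = ennreal (v - u) * (\<integral>\<^sup>+ s. ?g (u + (v - u) * s) \<partial>lborel)"
      by (intro nn_integral_cmult measurable_compose[OF _ C1_paths_speed_measurable[OF assms(1,2,4)]])
        simp
    also have "\<dots> = (\<integral>\<^sup>+ t. ?g t \<partial>lborel)"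
      using nn_integral_real_affine[OF C1_paths_speed_measurable[OF assms(1,2,4)], of "v - u" u] c
      by simp
    also have "\<dots> \<le> path_length \<gamma>"
      unfolding path_length_def using assms
      by (intro nn_integral_mono mult_left_mono) (auto simp: indicator_def)
    finally show ?thesis .
  qed
  then show ?thesis
    unfolding geod_dist_eq_Inf_path_length
    using subpath_affine_in_C1_paths(1)[OF assms] by (meson INF_lower2)
qed

section \<open>Elementary inequalities for weights and powers\<close>

text \<open>Here \<open>u\<close> and \<open>v\<close> stand for the density at the end points and
  \<open>w\<close> for its value in between. On \<open>[m, infinity)\<close> the logarithm is
  Lipschitz with constant \<open>1 / m\<close>; averaging the bounds for \<open>ln w\<close>
  obtained from \<open>u\<close> and from \<open>v\<close> produces the geometric mean of
  \<open>u\<close> and \<open>v\<close>.\<close>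

lemma weight_sandwich:
  fixes a m F l :: real
  assumes "0 \<le> a" "0 < m" "m \<le> u" "m \<le> v" "m \<le> w"
    and "\<bar>w - u\<bar> \<le> F * l" "\<bar>w - v\<bar> \<le> F * l"
  shows "exp (- (a * F / m * l)) * (u * v) powr (- a / 2) \<le> 1 / w powr a"
    and "1 / w powr a \<le> exp (a * F / m * l) * (u * v) powr (- a / 2)"
proof -
  have ln_lip: "ln r - ln s \<le> \<bar>r - s\<bar> / m" if "m \<le> r" "m \<le> s" for r s
  proof -
    have "ln r - ln s \<le> (r - s) / s" using that assms by (intro ln_diff_le) auto
    also have "\<dots> \<le> \<bar>r - s\<bar> / s" using that assms by (intro divide_right_mono) auto
    also have "\<dots> \<le> \<bar>r - s\<bar> / m" using that assms by (intro divide_left_mono) auto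
    finally show ?thesis .
  qed
  have bnd: "\<bar>w - u\<bar> / m \<le> F * l / m" "\<bar>w - v\<bar> / m \<le> F * l / m"
    using assms by (auto intro: divide_right_mono)
  have w: "1 / w powr a = exp (- (a * ln w))"
    using assms by (simp add: powr_def exp_minus field_simps)
  have uv: "(u * v) powr (- a / 2) = exp (- (a * ((ln u + ln v) / 2)))"
    using assms by (simp add: powr_def ln_mult)
  have "ln w \<le> (ln u + ln v) / 2 + F * l / m"
    using ln_lip[OF \<open>m \<le> w\<close> \<open>m \<le> u\<close>] ln_lip[OF \<open>m \<le> w\<close> \<open>m \<le> v\<close>] bnd by argo
  then have "a * ln w \<le> a * ((ln u + ln v) / 2) + a * F / m * l"
    using mult_left_mono[OF _ \<open>0 \<le> a\<close>] by (fastforce simp: distrib_left)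
  then show "exp (- (a * F / m * l)) * (u * v) powr (- a / 2) \<le> 1 / w powr a"
    unfolding w uv exp_add[symmetric] by simp
  have "(ln u + ln v) / 2 - F * l / m \<le> ln w"
    using ln_lip[OF \<open>m \<le> u\<close> \<open>m \<le> w\<close>] ln_lip[OF \<open>m \<le> v\<close> \<open>m \<le> w\<close>] bnd
    unfolding abs_minus_commute[of u w] abs_minus_commute[of v w] by argo
  then have "a * ((ln u + ln v) / 2) - a * F / m * l \<le> a * ln w"
    using mult_left_mono[OF _ \<open>0 \<le> a\<close>] by (fastforce simp: right_diff_distrib)
  then show "1 / w powr a \<le> exp (a * F / m * l) * (u * v) powr (- a / 2)"
    unfolding w uv exp_add[symmetric] by simp
qed

text \<open>Bernoulli's inequality for exponents in \<open>[0, 1]\<close>, as the weighted AM-GM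
  inequality for \<open>1 + z\<close> and \<open>1\<close> with weights \<open>q\<close> and
  \<open>1 - q\<close>.\<close>

lemma one_plus_powr_le:
  fixes q z :: real
  assumes "0 \<le> q" "q \<le> 1" "0 \<le> z"
  shows "(1 + z) powr q \<le> 1 + q * z"
  using Youngs_inequality_0[of q "1 - q" "1 + z" 1] assms by (simp add: algebra_simps)

text \<open>With \<open>h = 1 + \<kappa> * e\<^sup>2\<close>, the bound on \<open>L\<close> factors
  after taking powers into \<open>(e * G) powr q\<close>, \<open>h powr q\<close> and
  \<open>exp (q * B * e * h)\<close>. Bernoulli treats the second factor and
  \<open>exp z <= 1 + 2 * z\<close> the third; what exceeds second order is collected in the cubic
  term.\<close>

lemma powr_error_upper:
  fixes e D L G B q \<kappa> :: real
  assumes "0 \<le> e" "e \<le> 1" "0 \<le> D" "D \<le> e * (1 + \<kappa> * e\<^sup>2)" "0 \<le> \<kappa>" "0 \<le> B" "0 < G"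
    and "0 < q" "q \<le> 1" "B * (1 + \<kappa>) * e \<le> 1"
    and "0 \<le> L" "L \<le> D * (exp (B * D) * G)"
  shows "L powr q \<le> (e * G) powr q *
    (1 + 2 * q * B * e + q * \<kappa> * e\<^sup>2 + 2 * q * B * (2 * \<kappa> + \<kappa>\<^sup>2) * e ^ 3)"
proof -
  define h where "h = 1 + \<kappa> * e\<^sup>2"
  have e2: "e\<^sup>2 \<le> 1" using assms by (simp add: power_le_one)
  have h: "1 \<le> h" "h \<le> 1 + \<kappa>"
    using assms e2 mult_left_mono[OF e2 \<open>0 \<le> \<kappa>\<close>] by (auto simp: h_def)
  have Dh: "D \<le> e * h" using assms by (simp add: h_def)
  have BD: "B * D \<le> B * (e * h)" using Dh assms by (intro mult_left_mono) auto
  have Beh: "0 \<le> B * (e * h)" "B * (e * h) \<le> 1"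
  proof -
    have "B * (e * h) \<le> B * (e * (1 + \<kappa>))" using h assms by (intro mult_left_mono) auto
    then show "B * (e * h) \<le> 1" using assms by (simp add: algebra_simps)
  qed (use assms h in auto)
  have "L \<le> (e * h) * (exp (B * (e * h)) * G)"
    using assms Dh BD h by (intro order_trans[OF assms(12)] mult_mono) auto
  then have "L powr q \<le> ((e * h) * (exp (B * (e * h)) * G)) powr q"
    using assms by (intro powr_mono2) auto
  also have "\<dots> = (e * G) powr q * (h powr q * exp (q * (B * (e * h))))"
    using assms h by (simp add: powr_mult powr_def[of "exp _"] mult_ac)
  also have "\<dots> \<le> (e * G) powr q * ((1 + q * (\<kappa> * e\<^sup>2)) * (1 + 2 * (q * (B * (e * h)))))"
  proof (intro mult_left_mono mult_mono)
    show "h powr q \<le> 1 + q * (\<kappa> * e\<^sup>2)"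
      unfolding h_def using assms by (intro one_plus_powr_le) auto
    have z: "0 \<le> q * (B * (e * h))" "q * (B * (e * h)) \<le> 1"
      using Beh assms by (auto simp: mult_le_one)
    \<comment> \<open>On \<open>[0, 1]\<close> the square is at most \<open>z\<close> itself. This
      crude step doubles the first-order coefficient, which \<open>C\<^sub>1\<close> can
      afford.\<close>
    have "exp (q * (B * (e * h))) \<le> 1 + q * (B * (e * h)) + (q * (B * (e * h)))\<^sup>2"
      using z by (rule exp_bound)
    also have "(q * (B * (e * h)))\<^sup>2 \<le> q * (B * (e * h))"
      using z by (simp add: power2_eq_square mult_left_le)
    finally have "exp (q * (B * (e * h))) \<le> 1 + q * (B * (e * h)) + q * (B * (e * h))"
      by simp
    then show "exp (q * (B * (e * h))) \<le> 1 + 2 * (q * (B * (e * h)))"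
      by (simp only: mult_2 add.assoc)
  qed (use assms in auto)
  also have "\<dots> \<le> (e * G) powr q *
    (1 + 2 * q * B * e + q * \<kappa> * e\<^sup>2 + 2 * q * B * (2 * \<kappa> + \<kappa>\<^sup>2) * e ^ 3)"
  proof (intro mult_left_mono)
    \<comment> \<open>The bounds \<open>q <= 1\<close> and \<open>e ^ 4 <= e ^ 2\<close> leave one
      quadratic correction, which becomes the cubic term once multiplied by
      \<open>2 * q * B * e\<close>.\<close>
    have "(1 + q * (\<kappa> * e\<^sup>2)) * h \<le> (1 + \<kappa> * e\<^sup>2) * h"
      using assms h by (intro mult_right_mono) (auto simp: mult_left_le_one_le)
    also have "\<dots> = 1 + 2 * \<kappa> * e\<^sup>2 + \<kappa>\<^sup>2 * (e\<^sup>2 * e\<^sup>2)"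
      by (simp add: h_def power2_eq_square algebra_simps)
    also have "\<dots> \<le> 1 + 2 * \<kappa> * e\<^sup>2 + \<kappa>\<^sup>2 * (e\<^sup>2 * 1)"
      using e2 by (intro add_left_mono mult_left_mono) auto
    finally have "(1 + q * (\<kappa> * e\<^sup>2)) * h \<le> 1 + (2 * \<kappa> + \<kappa>\<^sup>2) * e\<^sup>2"
      by (simp add: algebra_simps)
    then have "(2 * q * B * e) * ((1 + q * (\<kappa> * e\<^sup>2)) * h)
        \<le> (2 * q * B * e) * (1 + (2 * \<kappa> + \<kappa>\<^sup>2) * e\<^sup>2)"
      using assms by (intro mult_left_mono) auto
    then show "(1 + q * (\<kappa> * e\<^sup>2)) * (1 + 2 * (q * (B * (e * h))))
       \<le> 1 + 2 * q * B * e + q * \<kappa> * e\<^sup>2 + 2 * q * B * (2 * \<kappa> + \<kappa>\<^sup>2) * e ^ 3"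
      by (simp add: algebra_simps power2_eq_square power3_eq_cube)
  qed auto
  finally show ?thesis .
qed

lemma powr_error_lower:
  fixes e L G B q :: real
  assumes "0 \<le> e" "0 \<le> B" "0 < G" "0 < q" "e * (exp (- (B * e)) * G) \<le> L"
  shows "(e * G) powr q * (1 - q * B * e) \<le> L powr q"
proof -
  have "1 - q * B * e \<le> exp (- (q * (B * e)))"
    using exp_ge_add_one_self[of "- (q * (B * e))"] by (simp add: mult_ac)
  then have "(e * G) powr q * (1 - q * B * e) \<le> (e * G) powr q * exp (- (q * (B * e)))"
    by (intro mult_left_mono) auto
  also have "\<dots> = (e * (exp (- (B * e)) * G)) powr q"
    using assms by (simp add: powr_mult powr_def[of "exp _"] mult_ac)
  also have "\<dots> \<le> L powr q" using assms by (intro powr_mono2) auto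
  finally show ?thesis .
qed

text \<open>The function \<open>t * exp (- (B * t))\<close> increases while
  \<open>B * t <= 1\<close>. Instead of differentiating, \<open>exp s >= 1 + s\<close> is applied at
  \<open>s = - B * (l - e)\<close>.\<close>

lemma mult_exp_neg_mono:
  fixes B e l :: real
  assumes "e \<le> l" "0 \<le> l" "B * l \<le> 1"
  shows "e * exp (- (B * e)) \<le> l * exp (- (B * l))"
proof -
  have "B * l * (l - e) \<le> 1 * (l - e)" using assms by (intro mult_right_mono) auto
  then have "e \<le> l * (1 - B * (l - e))" by (simp add: algebra_simps)
  also have "\<dots> \<le> l * exp (- (B * (l - e)))"
    using exp_ge_add_one_self[of "- (B * (l - e))"] assms by (intro mult_left_mono) auto
  finally have "e * exp (- (B * e)) \<le> l * exp (- (B * (l - e))) * exp (- (B * e))"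
    by (rule mult_right_mono) simp
  then show ?thesis by (simp add: mult.assoc exp_add[symmetric] algebra_simps)
qed

section \<open>Constant weights and the local density ratio\<close>

lemma nn_integral_const_speed:
  assumes "\<gamma> \<in> C1_paths M x y" "path_length \<gamma> = ennreal l" "0 \<le> c"
  shows "(\<integral>\<^sup>+ t\<in>{0..1}. ennreal (c * norm (vector_derivative \<gamma> (at t))) \<partial>lborel) = ennreal (c * l)"
proof -
  have "(\<integral>\<^sup>+ t\<in>{0..1}. ennreal (c * norm (vector_derivative \<gamma> (at t))) \<partial>lborel)
      = (\<integral>\<^sup>+ t. ennreal c * (ennreal (norm (vector_derivative \<gamma> (at t))) * indicator {0..1} t) \<partial>lborel)"
    using assms by (simp add: ennreal_mult mult.assoc)
  also have "\<dots> = ennreal c * path_length \<gamma>"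
    unfolding path_length_def using C1_paths_speed_measurable[OF assms(1), of 0 1]
    by (intro nn_integral_cmult) simp
  finally show ?thesis using assms by (simp add: ennreal_mult')
qed

text \<open>Both balls contain their centre, so \<open>f x\<close> lies between the local minimum
  and the local maximum. The upper bound ensures that the supremum defining \<open>\<rho>\<close> is
  taken over a bounded set.\<close>

lemma rho_loc_bounds:
  assumes "x \<in> M" "0 \<le> \<kappa>" "0 \<le> \<epsilon>" "0 < m" "\<And>z. z \<in> M \<Longrightarrow> m \<le> f z" "\<And>z. z \<in> M \<Longrightarrow> f z \<le> N"
  shows "1 \<le> rho_loc d p \<kappa> f M x \<epsilon>" "rho_loc d p \<kappa> f M x \<epsilon> \<le> N / m"
proof -
  have bdd: "bdd_below (f ` A)" "bdd_above (f ` A)" if "A \<subseteq> M" for A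
    using that assms(5,6) by (auto intro!: bdd_belowI2[where m = m] bdd_aboveI2[where M = N])
  have ball: "dist_ball M \<delta> x r \<subseteq> M" for \<delta> r by (auto simp: dist_ball_def)
  have "geod_dist M x x = 0"
    using INF_lower[OF const_path[OF assms(1)],
        of "\<lambda>\<gamma>. \<integral>\<^sup>+ t\<in>{0..1}. ennreal (norm (vector_derivative \<gamma> (at t))) \<partial>lborel"]
    by (simp add: geod_dist_def)
  then have x1: "x \<in> dist_ball M (geod_dist M) x (\<epsilon> * (1 + \<kappa> * \<epsilon>\<^sup>2))"
    using assms by (simp add: dist_ball_def)
  have "Lpp d p f M x x = 0"
    using INF_lower[OF const_path[OF assms(1)],
        of "\<lambda>\<gamma>. \<integral>\<^sup>+ t\<in>{0..1}. ennreal (1 / f (\<gamma> t) powr ((p - 1) / real d) *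
          norm (vector_derivative \<gamma> (at t))) \<partial>lborel"]
    by (simp add: Lpp_def)
  then have x2: "x \<in> dist_ball M (Lpp d p f M) x r" for r
    using assms by (simp add: dist_ball_def)
  have "m \<le> f_min_loc \<kappa> f M x \<epsilon>"
    unfolding f_min_loc_def using x1 ball assms(5) by (intro cINF_greatest) blast+
  moreover have "f_min_loc \<kappa> f M x \<epsilon> \<le> f x"
    unfolding f_min_loc_def by (intro cINF_lower bdd ball x1)
  moreover have "f x \<le> f_max_loc d p \<kappa> f M x \<epsilon>"
    unfolding f_max_loc_def by (intro cSUP_upper bdd ball x2)
  moreover have "f_max_loc d p \<kappa> f M x \<epsilon> \<le> N"
    unfolding f_max_loc_def using x2 ball assms(6) by (intro cSUP_least) blast+
  ultimately show "1 \<le> rho_loc d p \<kappa> f M x \<epsilon>" "rho_loc d p \<kappa> f M x \<epsilon> \<le> N / m"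
    unfolding rho_loc_def using \<open>0 < m\<close> by (auto intro!: frac_le)
qed

section \<open>Two-sided estimates of \<open>Lpp\<close> for a fixed density\<close>

context
  fixes M :: "(real^'n) set" and f :: "real^'n \<Rightarrow> real" and m N F p a B :: real and d :: nat
  assumes m: "0 < m" and m_le: "\<And>z. z \<in> M \<Longrightarrow> m \<le> f z" and le_N: "\<And>z. z \<in> M \<Longrightarrow> f z \<le> N"
    and lip: "geod_lipschitz F M f"
    and a_def: "a = (p - 1) / real d" and a: "0 \<le> a" and B_def: "B = a * F / m"
begin

lemma B_nonneg: "0 \<le> B"
  using m a lip by (simp add: B_def geod_lipschitz_def)

lemma lipschitz_le:
  assumes "u \<in> M" "v \<in> M" "geod_dist M u v \<le> ennreal l" "0 \<le> l"
  shows "\<bar>f u - f v\<bar> \<le> F * l"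
proof -
  have "geod_dist M u v < \<infinity>" using assms(3) le_less_trans by fastforce
  then have "\<bar>f u - f v\<bar> \<le> F * enn2real (geod_dist M u v)"
    using lip assms by (simp add: geod_lipschitz_def)
  also have "\<dots> \<le> F * l"
    using lip enn2real_mono[OF assms(3)] assms(4)
    by (intro mult_left_mono) (auto simp: geod_lipschitz_def)
  finally show ?thesis .
qed

lemma C1_paths_in: "\<gamma> \<in> C1_paths M x y \<Longrightarrow> t \<in> {0..1} \<Longrightarrow> \<gamma> t \<in> M"
  by (auto simp: C1_paths_def)

text \<open>The point \<open>\<gamma> t\<close> is joined to each end by a piece of the path, so its
  geodesic distance to either end is at most \<open>l\<close> and \<open>weight_sandwich\<close>
  applies.\<close>

lemma weight_on_path:
  assumes "\<gamma> \<in> C1_paths M x y" "path_length \<gamma> = ennreal l" "0 \<le> l" "t \<in> {0..1}"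
  shows "exp (- (B * l)) * (f x * f y) powr (- a / 2) \<le> 1 / f (\<gamma> t) powr a"
    and "1 / f (\<gamma> t) powr a \<le> exp (B * l) * (f x * f y) powr (- a / 2)"
proof -
  have ends: "\<gamma> 0 = x" "\<gamma> 1 = y" using assms(1) by (auto simp: C1_paths_def)
  have M: "x \<in> M" "y \<in> M" "\<gamma> t \<in> M"
    using C1_paths_in[OF assms(1), of 0] C1_paths_in[OF assms(1), of 1] C1_paths_in[OF assms(1,4)] ends by auto
  have "\<bar>f (\<gamma> t) - f x\<bar> \<le> F * l" "\<bar>f (\<gamma> t) - f y\<bar> \<le> F * l"
    using lipschitz_le[OF M(1,3), of l] lipschitz_le[OF M(3,2), of l]
      geod_dist_le_path_length[OF assms(1), of 0 t] geod_dist_le_path_length[OF assms(1), of t 1]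
      assms ends by (auto simp: abs_minus_commute)
  note * = weight_sandwich[OF a m m_le[OF M(1)] m_le[OF M(2)] m_le[OF M(3)] this, folded B_def]
  show "exp (- (B * l)) * (f x * f y) powr (- a / 2) \<le> 1 / f (\<gamma> t) powr a"
    using *(1) by (simp add: B_def)
  show "1 / f (\<gamma> t) powr a \<le> exp (B * l) * (f x * f y) powr (- a / 2)" using *(2) .
qed

lemma Lpp_le_const_mult_length:
  assumes "\<gamma> \<in> C1_paths M x y" "path_length \<gamma> = ennreal l" "0 \<le> c"
    and "\<And>t. t \<in> {0..1} \<Longrightarrow> 1 / f (\<gamma> t) powr a \<le> c"
  shows "Lpp d p f M x y \<le> ennreal (c * l)"
proof -
  have "Lpp d p f M x y \<le> (\<integral>\<^sup>+ t\<in>{0..1}.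
        ennreal (1 / f (\<gamma> t) powr ((p - 1) / real d) * norm (vector_derivative \<gamma> (at t))) \<partial>lborel)"
    unfolding Lpp_def by (rule INF_lower[OF assms(1)])
  also have "\<dots> \<le> (\<integral>\<^sup>+ t\<in>{0..1}. ennreal (c * norm (vector_derivative \<gamma> (at t))) \<partial>lborel)"
    unfolding a_def[symmetric] using assms(4)
    by (intro nn_integral_mono) (auto simp: indicator_def simp del: times_divide_eq_left
      intro!: ennreal_leI mult_right_mono)
  also have "\<dots> = ennreal (c * l)" by (rule nn_integral_const_speed[OF assms(1-3)])
  finally show ?thesis .
qed

text \<open>Stated for a single path: in the lower estimate \<open>c\<close> depends on the path,
  and the infimum is taken only afterwards.\<close>

lemma le_weighted_length:
  assumes "\<gamma> \<in> C1_paths M x y" "path_length \<gamma> = ennreal l" "0 \<le> c"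
    and "\<And>t. t \<in> {0..1} \<Longrightarrow> c \<le> 1 / f (\<gamma> t) powr a"
  shows "ennreal (c * l) \<le> (\<integral>\<^sup>+ t\<in>{0..1}.
    ennreal (1 / f (\<gamma> t) powr a * norm (vector_derivative \<gamma> (at t))) \<partial>lborel)"
  unfolding nn_integral_const_speed[OF assms(1-3), symmetric]
proof (intro nn_integral_mono)
  fix t :: real
  show "ennreal (c * norm (vector_derivative \<gamma> (at t))) * indicator {0..1} t
    \<le> ennreal (1 / f (\<gamma> t) powr a * norm (vector_derivative \<gamma> (at t))) * indicator {0..1} t"
  proof (cases "t \<in> {0..1}")
    case True
    show ?thesis
      by (intro mult_right_mono ennreal_leI assms(4) True) simp_all
  qed simp
qed

text \<open>A shortest path need not exist. For each \<open>l > D\<close> there is a path shorter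
  than \<open>l\<close>, which gives the bound with \<open>l\<close> in place of \<open>D\<close>;
  then \<open>l\<close> tends to \<open>D\<close> from the right.\<close>

lemma Lpp_le:
  assumes "geod_dist M x y \<le> ennreal D" "0 \<le> D"
  shows "Lpp d p f M x y \<le> ennreal (D * (exp (B * D) * (f x * f y) powr (- a / 2)))"
proof -
  let ?G = "(f x * f y) powr (- a / 2)"
  have *: "Lpp d p f M x y \<le> ennreal (l * (exp (B * l) * ?G))" if "D < l" for l
  proof -
    have "geod_dist M x y < ennreal l"
      using that assms by (intro le_less_trans[OF assms(1)] ennreal_lessI) auto
    then obtain \<gamma> where \<gamma>: "\<gamma> \<in> C1_paths M x y" "path_length \<gamma> < ennreal l"
      unfolding geod_dist_eq_Inf_path_length INF_less_iff by blast
    obtain l' where l': "path_length \<gamma> = ennreal l'" "0 \<le> l'" by (rule path_length_real[OF \<gamma>(1)])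
    then have "l' \<le> l" using \<gamma>(2) by (simp add: ennreal_less_iff)
    have "Lpp d p f M x y \<le> ennreal (exp (B * l') * ?G * l')"
      by (rule Lpp_le_const_mult_length[OF \<gamma>(1) l'(1) _ weight_on_path(2)[OF \<gamma>(1) l']]) simp_all
    also have "\<dots> \<le> ennreal (exp (B * l) * ?G * l)"
      using \<open>l' \<le> l\<close> l'(2) B_nonneg
      by (intro ennreal_leI mult_mono) (auto intro: mult_left_mono)
    finally show ?thesis by (simp add: mult_ac)
  qed
  have "((\<lambda>l. ennreal (l * (exp (B * l) * ?G))) \<longlongrightarrow> ennreal (D * (exp (B * D) * ?G))) (at_right D)"
    by (intro tendsto_ennrealI tendsto_intros)
  moreover have "\<forall>\<^sub>F l in at_right D. Lpp d p f M x y \<le> ennreal (l * (exp (B * l) * ?G))"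
    using * by (simp add: eventually_at_right_less eventually_mono[OF eventually_at_right_less])
  ultimately show ?thesis by (intro tendsto_lowerbound) auto
qed

text \<open>Makes the error constants uniform in \<open>x\<close> and \<open>y\<close>.\<close>

lemma geometric_weight_le:
  assumes "x \<in> M" "y \<in> M"
  shows "(f x * f y) powr (- a / 2) \<le> m powr (- a)"
proof -
  have "(f x * f y) powr (- a / 2) \<le> (m * m) powr (- a / 2)"
    using m m_le[OF assms(1)] m_le[OF assms(2)] a by (intro powr_mono2' mult_mono) auto
  also have "\<dots> = m powr (- a)" using m by (simp add: powr_mult powr_add[symmetric])
  finally show ?thesis .
qed

text \<open>
  A path with \<open>B * l \<le> 1\<close> is handled by monotonicity of \<open>l * exp (- B * l)\<close>; a longer one has
  weighted length bounded below by a constant and cannot be nearly minimal for close endpoints.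
\<close>

lemma le_Lpp:
  assumes "x \<in> M" "y \<in> M" "B * (N powr a * m powr (- a)) * norm (x - y) \<le> 1"
  shows "ennreal (norm (x - y) * (exp (- (B * norm (x - y))) * (f x * f y) powr (- a / 2)))
    \<le> Lpp d p f M x y"
  unfolding Lpp_def a_def[symmetric]
proof (intro INF_greatest)
  fix \<gamma> assume \<gamma>: "\<gamma> \<in> C1_paths M x y"
  let ?e = "norm (x - y)" and ?G = "(f x * f y) powr (- a / 2)"
  obtain l where l: "path_length \<gamma> = ennreal l" "0 \<le> l" by (rule path_length_real[OF \<gamma>])
  have el: "?e \<le> l" using norm_diff_le_path_length[OF \<gamma>] l by simp
  have "\<exists>c\<ge>0. (\<forall>t\<in>{0..1}. c \<le> 1 / f (\<gamma> t) powr a) \<and> ?e * (exp (- (B * ?e)) * ?G) \<le> c * l"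
  proof (cases "B * l \<le> 1")
    case True
    have "?e * exp (- (B * ?e)) * ?G \<le> l * exp (- (B * l)) * ?G"
      using mult_exp_neg_mono[OF el l(2) True] by (intro mult_right_mono) auto
    then show ?thesis using weight_on_path(1)[OF \<gamma> l]
      by (intro exI[of _ "exp (- (B * l)) * ?G"]) (auto simp: mult_ac)
  next
    case False
    have N: "0 < N" using m m_le[OF assms(1)] le_N[OF assms(1)] by linarith
    have "B * (N powr a * m powr (- a) * ?e) < B * l" using assms(3) False by (simp add: mult_ac)
    \<comment> \<open>The strict inequality excludes \<open>B = 0\<close>, so \<open>B\<close>
      cancels.\<close>
    then have "N powr a * m powr (- a) * ?e < l" using B_nonneg by (simp add: mult_less_cancel_left)
    then have "m powr (- a) * ?e \<le> l / N powr a" using N by (simp add: field_simps)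
    moreover have "?e * (exp (- (B * ?e)) * ?G) \<le> ?e * (1 * m powr (- a))"
      using B_nonneg geometric_weight_le[OF assms(1,2)] by (intro mult_left_mono mult_mono) auto
    ultimately have "?e * (exp (- (B * ?e)) * ?G) \<le> 1 / N powr a * l" by (simp add: mult_ac)
    moreover have "1 / N powr a \<le> 1 / f (\<gamma> t) powr a" if "t \<in> {0..1}" for t
      using m m_le[OF C1_paths_in[OF \<gamma> that]] le_N[OF C1_paths_in[OF \<gamma> that]] a N
      by (intro divide_left_mono powr_mono2) auto
    ultimately show ?thesis by (intro exI[of _ "1 / N powr a"]) auto
  qed
  then obtain c where c: "0 \<le> c" "\<And>t. t \<in> {0..1} \<Longrightarrow> c \<le> 1 / f (\<gamma> t) powr a"
    "?e * (exp (- (B * ?e)) * ?G) \<le> c * l" by blast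
  show "ennreal (?e * (exp (- (B * ?e)) * ?G)) \<le> (\<integral>\<^sup>+ t\<in>{0..1}.
      ennreal (1 / f (\<gamma> t) powr a * norm (vector_derivative \<gamma> (at t))) \<partial>lborel)"
    using le_weighted_length[OF \<gamma> l(1) c(1,2)] ennreal_leI[OF c(3)] by (rule order_trans[rotated])
qed

section \<open>Error of \<open>Lp\<close> against the stretch distance\<close>

lemma stretch_dist_powr:
  "stretch_dist d p f x y powr q = (norm (x - y) * (f x * f y) powr (- a / 2)) powr q"
proof -
  have "(p - 1) / (2 * real d) = a / 2" by (simp add: a_def)
  moreover have "(f x * f y) powr (- a / 2) = 1 / (f x * f y) powr (a / 2)"
    using powr_minus_divide[of "f x * f y" "a / 2"] by (simp only: minus_divide_left)
  ultimately show ?thesis by (simp only: stretch_dist_def times_divide_eq_right mult_1_right)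
qed

text \<open>For close points the bounds on \<open>Lpp\<close> turn into an error relative to
  \<open>(e * G) powr q\<close>. Replacing \<open>e\<close> by \<open>\<epsilon>\<close> and
  \<open>G\<close> by \<open>m powr (- a)\<close> then removes the dependence on \<open>x\<close>
  and \<open>y\<close>.\<close>

lemma Lp_error_near:
  assumes "x \<in> M" "y \<in> M" "1 \<le> p" "0 \<le> \<kappa>"
    and "geod_dist M x y \<le> ennreal (norm (x - y) * (1 + \<kappa> * (norm (x - y))\<^sup>2))"
    and "norm (x - y) \<le> \<epsilon>" "norm (x - y) \<le> 1"
    and "B * (N powr a * m powr (- a)) * norm (x - y) \<le> 1"
    and "B * (1 + \<kappa>) * norm (x - y) \<le> 1"
  defines "q \<equiv> 1 / p"
  shows "\<bar>Lp d p f M x y - stretch_dist d p f x y powr q\<bar> \<le> m powr (- a * q) *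
    (2 * q * B * \<epsilon> powr (1 + q) + q * \<kappa> * \<epsilon> powr (2 + q)
      + 2 * q * B * (2 * \<kappa> + \<kappa>\<^sup>2) * \<epsilon> powr (3 + q))"
proof -
  define e where "e = norm (x - y)"
  define G where "G = (f x * f y) powr (- a / 2)"
  define D where "D = e * (1 + \<kappa> * e\<^sup>2)"
  define L where "L = enn2real (Lpp d p f M x y)"
  define K where "K = 2 * q * B * (2 * \<kappa> + \<kappa>\<^sup>2)"
  have q: "0 < q" "q \<le> 1" using assms by (auto simp: q_def)
  have e: "0 \<le> e" "e \<le> \<epsilon>" by (use assms in \<open>simp_all add: e_def\<close>)
  have D: "0 \<le> D" using e assms by (simp add: D_def)
  have K: "0 \<le> K" using q B_nonneg assms by (simp add: K_def)
  have G: "0 < G" using m m_le[OF assms(1)] m_le[OF assms(2)] by (simp add: G_def)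
  have up: "Lpp d p f M x y \<le> ennreal (D * (exp (B * D) * G))"
    unfolding G_def using D assms(5) by (intro Lpp_le) (simp_all add: D_def e_def)
  have lo: "ennreal (e * (exp (- (B * e)) * G)) \<le> Lpp d p f M x y"
    unfolding e_def G_def by (rule le_Lpp[OF assms(1,2,8)])
  \<comment> \<open>The upper bound makes \<open>Lpp\<close> finite, so nothing is lost in passing
    to a real number.\<close>
  have fin: "Lpp d p f M x y = ennreal L"
    unfolding L_def using up ennreal_less_top le_less_trans by (intro ennreal_enn2real[symmetric]) blast
  have L: "0 \<le> L" by (simp add: L_def)
  have up': "L \<le> D * (exp (B * D) * G)" using up D G unfolding fin by (subst (asm) ennreal_le_iff) auto
  have lo': "e * (exp (- (B * e)) * G) \<le> L" using lo L unfolding fin by (subst (asm) ennreal_le_iff) auto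
  have "L powr q \<le> (e * G) powr q * (1 + 2 * q * B * e + q * \<kappa> * e\<^sup>2 + K * e ^ 3)"
    unfolding K_def using e D G q L up' assms B_nonneg
    by (intro powr_error_upper[where D = D]) (simp_all add: D_def e_def)
  moreover have "(e * G) powr q * (1 - q * B * e) \<le> L powr q"
    by (rule powr_error_lower[OF e(1) B_nonneg G q(1) lo'])
  \<comment> \<open>The lower error \<open>q * B * e\<close> is weakened to the upper one so that a
    single absolute value covers both.\<close>
  moreover have "(e * G) powr q * (1 - (2 * q * B * e + q * \<kappa> * e\<^sup>2 + K * e ^ 3))
      \<le> (e * G) powr q * (1 - q * B * e)"
  proof (intro mult_left_mono)
    have "0 \<le> q * B * e" "0 \<le> q * \<kappa> * e\<^sup>2" "0 \<le> K * e ^ 3"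
      using e q B_nonneg K assms(4) by simp_all
    then show "1 - (2 * q * B * e + q * \<kappa> * e\<^sup>2 + K * e ^ 3) \<le> 1 - q * B * e" by linarith
  qed simp
  ultimately have "\<bar>L powr q - (e * G) powr q\<bar>
      \<le> (e * G) powr q * (2 * q * B * e + q * \<kappa> * e\<^sup>2 + K * e ^ 3)"
    by (simp add: algebra_simps abs_le_iff)
  also have "\<dots> \<le> (\<epsilon> * m powr (- a)) powr q * (2 * q * B * \<epsilon> + q * \<kappa> * \<epsilon>\<^sup>2 + K * \<epsilon> ^ 3)"
    using e q B_nonneg K assms(4) G geometric_weight_le[OF assms(1,2)]
    by (intro mult_mono powr_mono2 add_mono mult_left_mono power_mono) (auto simp: G_def)
  also have "\<dots> = m powr (- a * q) * (2 * q * B * \<epsilon> powr (1 + q) + q * \<kappa> * \<epsilon> powr (2 + q)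
      + K * \<epsilon> powr (3 + q))"
  proof -
    have "(\<epsilon> * m powr (- a)) powr q = \<epsilon> powr q * m powr (- a * q)"
      using e m by (simp add: powr_mult powr_powr)
    \<comment> \<open>The value \<open>\<epsilon> = 0\<close> is possible here; both sides then
      vanish because \<open>0 powr q = 0\<close>.\<close>
    moreover have "\<epsilon> powr (real n + q) = \<epsilon> ^ n * \<epsilon> powr q" for n
      using e q by (cases "\<epsilon> = 0") (auto simp: powr_add powr_realpow)
    from this[of 1] this[of 2] this[of 3]
    have "\<epsilon> powr (1 + q) = \<epsilon> * \<epsilon> powr q" "\<epsilon> powr (2 + q) = \<epsilon>\<^sup>2 * \<epsilon> powr q"
      "\<epsilon> powr (3 + q) = \<epsilon> ^ 3 * \<epsilon> powr q" by simp_all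
    ultimately show ?thesis by (simp add: algebra_simps)
  qed
  finally show ?thesis
    unfolding stretch_dist_powr Lp_def K_def e_def G_def L_def q_def .
qed

text \<open>Both quantities lie between \<open>0\<close> and the same constant, so their difference
  is bounded by it, however far apart the points are within geodesic distance
  \<open>D\<close>.\<close>

lemma Lp_error_far:
  assumes "x \<in> M" "y \<in> M" "1 \<le> p" "geod_dist M x y \<le> ennreal D" "0 \<le> D"
  shows "\<bar>Lp d p f M x y - stretch_dist d p f x y powr (1 / p)\<bar>
    \<le> (D * (exp (B * D) * m powr (- a))) powr (1 / p)"
proof -
  let ?G = "(f x * f y) powr (- a / 2)" and ?K = "D * (exp (B * D) * m powr (- a))"
  have G: "?G \<le> m powr (- a)" by (rule geometric_weight_le[OF assms(1,2)])
  have "Lpp d p f M x y \<le> ennreal (D * (exp (B * D) * ?G))" by (rule Lpp_le[OF assms(4,5)])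
  also have "\<dots> \<le> ennreal ?K" using G assms by (intro ennreal_leI mult_left_mono) auto
  finally have "enn2real (Lpp d p f M x y) \<le> ?K" using assms by (intro enn2real_leI) auto
  then have "Lp d p f M x y \<le> ?K powr (1 / p)"
    unfolding Lp_def using assms by (intro powr_mono2) auto
  moreover have "norm (x - y) \<le> D"
    using order_trans[OF norm_diff_le_geod_dist assms(4)] assms(5) by simp
  then have "norm (x - y) * ?G \<le> D * (exp (B * D) * m powr (- a))"
    using G assms B_nonneg mult_mono[of 1 "exp (B * D)" ?G "m powr (- a)"]
    by (intro mult_mono) auto
  then have "stretch_dist d p f x y powr (1 / p) \<le> ?K powr (1 / p)"
    unfolding stretch_dist_powr using assms by (intro powr_mono2) auto
  moreover have "0 \<le> Lp d p f M x y" "0 \<le> stretch_dist d p f x y powr (1 / p)"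
    by (simp_all add: Lp_def)
  ultimately show ?thesis by linarith
qed

end

section \<open>Choice of the remainder and comparison of constants\<close>

theorem theorem2p3:
  fixes M :: "(real^'n) set" and f :: "real^'n \<Rightarrow> real"
    and \<kappa> \<epsilon>\<^sub>0 p F :: real and d :: nat
  assumes "d = CARD('d::finite)"
    and "0 \<le> \<kappa>" and "0 < \<epsilon>\<^sub>0"
    and "M \<in> manifold_class TYPE('d) \<kappa> \<epsilon>\<^sub>0"
    and "1 \<le> p"
    and "prob_density_on TYPE('d) M f"
    and "bounded (f ` M)"
    and "0 < (INF x\<in>M. f x)"
    and "geod_lipschitz F M f"
  shows "\<exists>R :: real \<Rightarrow> real. R \<in> O[at_right 0](\<lambda>\<epsilon>. \<epsilon> powr (3 + 1 / p)) \<and>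
    (\<forall>\<epsilon>>0.
      let f_min = (INF x\<in>M. f x);
          \<rho> = (SUP x\<in>M. rho_loc d p \<kappa> f M x \<epsilon>);
          C\<^sub>1 = F * (\<rho> powr ((p - 1) / real d) + 1) * (p - 1)
                 / (f_min powr (1 + (p - 1) / (p * real d)) * (p * real d));
          C\<^sub>2 = \<kappa> / (f_min powr ((p - 1) / (p * real d)) * p)
      in \<forall>x\<in>M. \<forall>y\<in>M. geod_dist M x y \<le> ennreal \<epsilon>\<^sub>0 \<longrightarrow> norm (x - y) \<le> \<epsilon> \<longrightarrow>
           \<bar>Lp d p f M x y - stretch_dist d p f x y powr (1 / p)\<bar>
             \<le> C\<^sub>1 * \<epsilon> powr (1 + 1 / p) + C\<^sub>2 * \<epsilon> powr (2 + 1 / p) + R \<epsilon>)"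
proof -
  define m where "m = (INF x\<in>M. f x)"
  define a where "a = (p - 1) / real d"
  define B where "B = a * F / m"
  define q where "q = 1 / p"
  have d: "0 < real d" using assms(1) by simp
  have a: "0 \<le> a" using assms(5) by (simp add: a_def)
  have q: "0 < q" "q \<le> 1" using assms(5) by (auto simp: q_def)
  have m: "0 < m" using assms(8) by (simp add: m_def)
  have m_le: "m \<le> f z" if "z \<in> M" for z
    unfolding m_def using that assms(7) by (intro cINF_lower bounded_imp_bdd_below)
  obtain N where N: "\<And>z. z \<in> M \<Longrightarrow> f z \<le> N"
    using bounded_imp_bdd_above[OF assms(7)] by (auto simp: bdd_above_def)
  have F: "0 \<le> F" using assms(9) by (simp add: geod_lipschitz_def)
  note ctx = m m_le N assms(9) a_def a B_def
  have B: "0 \<le> B" using a F m by (simp add: B_def)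
  \<comment> \<open>Each summand is the coefficient in one smallness condition of
    \<open>Lp_error_near\<close>, so \<open>norm (x - y) <= 1 / S\<close> yields all three at
    once.\<close>
  define S where "S = 1 + B * (1 + \<kappa>) + B * (N powr a * m powr (- a))"
  define e\<^sub>1 where "e\<^sub>1 = 1 / S"
  \<comment> \<open>The first summand is the cubic coefficient for close points. The second is the
    bound of \<open>Lp_error_far\<close> with \<open>D = \<epsilon>\<^sub>0\<close>, scaled so that
    its product with \<open>\<epsilon> powr (3 + q)\<close> dominates that bound once
    \<open>\<epsilon> >= e\<^sub>1\<close>.\<close>
  define K where "K = m powr (- a * q) * (2 * q * B * (2 * \<kappa> + \<kappa>\<^sup>2))
    + (\<epsilon>\<^sub>0 * (exp (B * \<epsilon>\<^sub>0) * m powr (- a))) powr q / e\<^sub>1 powr (3 + q)"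
  define R where "R = (\<lambda>\<epsilon>::real. K * \<epsilon> powr (3 + q))"
  have terms: "0 \<le> B * (1 + \<kappa>)" "0 \<le> B * (N powr a * m powr (- a))" using B assms(2) by auto
  then have "0 < S" unfolding S_def by linarith
  then have e1: "0 < e\<^sub>1" by (simp add: e\<^sub>1_def)
  have "R \<in> O[at_right 0](\<lambda>\<epsilon>. \<epsilon> powr (3 + 1 / p))" by (simp add: R_def q_def)
  moreover have "\<bar>Lp d p f M x y - stretch_dist d p f x y powr (1 / p)\<bar>
      \<le> F * ((SUP x\<in>M. rho_loc d p \<kappa> f M x \<epsilon>) powr ((p - 1) / real d) + 1) * (p - 1)
           / (m powr (1 + (p - 1) / (p * real d)) * (p * real d)) * \<epsilon> powr (1 + 1 / p)
        + \<kappa> / (m powr ((p - 1) / (p * real d)) * p) * \<epsilon> powr (2 + 1 / p) + R \<epsilon>"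
    if "0 < \<epsilon>" "x \<in> M" "y \<in> M" "geod_dist M x y \<le> ennreal \<epsilon>\<^sub>0" "norm (x - y) \<le> \<epsilon>" for \<epsilon> x y
  proof -
    define \<rho> where "\<rho> = (SUP x\<in>M. rho_loc d p \<kappa> f M x \<epsilon>)"
    have rho: "1 \<le> rho_loc d p \<kappa> f M z \<epsilon>" "rho_loc d p \<kappa> f M z \<epsilon> \<le> N / m" if "z \<in> M" for z
      using rho_loc_bounds[OF that assms(2) _ m m_le N, of \<epsilon>] \<open>0 < \<epsilon>\<close> by simp_all
    have "1 \<le> \<rho>"
      unfolding \<rho>_def using \<open>x \<in> M\<close> rho by (intro cSUP_upper2 bdd_aboveI2) auto
    then have "1 \<le> \<rho> powr a" using a by (intro ge_one_powr_ge_zero)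
    have exponent: "(p - 1) / (p * real d) = a * q" by (simp add: a_def q_def)
    \<comment> \<open>In this form \<open>C\<^sub>1\<close> differs from the first-order coefficient
      of \<open>Lp_error_near\<close> only in having \<open>\<rho> powr a + 1\<close> in place of
      \<open>2\<close>.\<close>
    have C1: "F * (\<rho> powr ((p - 1) / real d) + 1) * (p - 1)
        / (m powr (1 + (p - 1) / (p * real d)) * (p * real d))
        = q * B * (\<rho> powr a + 1) * m powr (- a * q)"
    proof -
      have "p - 1 = a * real d" using d by (simp add: a_def)
      moreover have "m powr (1 + a * q) = m * m powr (a * q)" using m by (simp add: powr_add)
      moreover have "m powr (- a * q) = 1 / m powr (a * q)" by (simp add: powr_minus_divide)
      moreover have "0 < m powr (a * q)" using m by simp
      ultimately show ?thesis
        unfolding exponent a_def[symmetric] B_def using d m assms(5) by (simp add: q_def mult_ac)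
    qed
    have C2: "\<kappa> / (m powr ((p - 1) / (p * real d)) * p) = q * \<kappa> * m powr (- a * q)"
    proof -
      have "m powr (- a * q) = 1 / m powr (a * q)" by (simp add: powr_minus_divide)
      then show ?thesis unfolding exponent by (simp only: q_def) simp
    qed
    have slack: "2 * q * B * m powr (- a * q) \<le> q * B * (\<rho> powr a + 1) * m powr (- a * q)"
    proof (rule mult_right_mono)
      have "(q * B) * 2 \<le> (q * B) * (\<rho> powr a + 1)"
        using q B \<open>1 \<le> \<rho> powr a\<close> by (intro mult_left_mono) auto
      then show "2 * q * B \<le> q * B * (\<rho> powr a + 1)" by (simp add: mult_ac)
    qed simp
    let ?main = "2 * q * B * m powr (- a * q) * \<epsilon> powr (1 + q) + q * \<kappa> * m powr (- a * q) * \<epsilon> powr (2 + q)"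
    let ?near = "m powr (- a * q) * (2 * q * B * (2 * \<kappa> + \<kappa>\<^sup>2))"
    let ?far = "(\<epsilon>\<^sub>0 * (exp (B * \<epsilon>\<^sub>0) * m powr (- a))) powr q"
    have R: "R \<epsilon> = ?near * \<epsilon> powr (3 + q) + ?far * (\<epsilon> powr (3 + q) / e\<^sub>1 powr (3 + q))"
      by (simp add: R_def K_def algebra_simps)
    have pos: "0 \<le> ?main" "0 \<le> ?near * \<epsilon> powr (3 + q)"
      "0 \<le> ?far * (\<epsilon> powr (3 + q) / e\<^sub>1 powr (3 + q))" using q B assms(2) by auto
    have "\<bar>Lp d p f M x y - stretch_dist d p f x y powr q\<bar> \<le> ?main + R \<epsilon>"
    proof (cases "norm (x - y) \<le> e\<^sub>1")
      case True
      then have S: "S * norm (x - y) \<le> 1"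
        using \<open>0 < S\<close> by (simp add: e\<^sub>1_def pos_le_divide_eq mult.commute)
      have *: "c * norm (x - y) \<le> 1" if "c \<le> S" for c
        using mult_right_mono[OF that norm_ge_zero[of "x - y"]] S by linarith
      have small: "norm (x - y) \<le> 1" "B * (N powr a * m powr (- a)) * norm (x - y) \<le> 1"
        "B * (1 + \<kappa>) * norm (x - y) \<le> 1"
        using *[of 1] *[of "B * (N powr a * m powr (- a))"] *[of "B * (1 + \<kappa>)"] terms
        unfolding S_def by linarith+
      have "geod_dist M x y \<le> ennreal (norm (x - y) * (1 + \<kappa> * (norm (x - y))\<^sup>2))"
        using assms(4) that by (simp add: manifold_class_def)
      from Lp_error_near[OF ctx that(2,3) assms(5,2) this that(5) small, folded q_def]
      have "\<bar>Lp d p f M x y - stretch_dist d p f x y powr q\<bar> \<le> ?main + ?near * \<epsilon> powr (3 + q)"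
        by (simp add: algebra_simps)
      then show ?thesis using pos(3) unfolding R by linarith
    next
      case False
      \<comment> \<open>Here \<open>\<epsilon> >= norm (x - y) > e\<^sub>1\<close>, so the quotient
        of powers is at least \<open>1\<close> and the bounded error fits into
        \<open>R \<epsilon>\<close>.\<close>
      then have "e\<^sub>1 powr (3 + q) \<le> \<epsilon> powr (3 + q)"
        using e1 q that(5) by (intro powr_mono2) auto
      then have "1 \<le> \<epsilon> powr (3 + q) / e\<^sub>1 powr (3 + q)"
        using e1 by (subst le_divide_eq_1_pos) auto
      then have "?far * 1 \<le> ?far * (\<epsilon> powr (3 + q) / e\<^sub>1 powr (3 + q))"
        by (intro mult_left_mono) auto
      moreover have "\<bar>Lp d p f M x y - stretch_dist d p f x y powr q\<bar> \<le> ?far"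
        using Lp_error_far[OF ctx that(2,3) assms(5) that(4)] assms(3) by (simp add: q_def)
      ultimately show ?thesis using pos unfolding R by linarith
    qed
    moreover have "?main \<le> q * B * (\<rho> powr a + 1) * m powr (- a * q) * \<epsilon> powr (1 + q)
        + q * \<kappa> * m powr (- a * q) * \<epsilon> powr (2 + q)"
      by (rule add_right_mono, rule mult_right_mono[OF slack]) simp
    ultimately show ?thesis
      unfolding \<rho>_def[symmetric] C1 C2 q_def[symmetric] by (rule order_trans[OF _ add_right_mono])
  qed
  ultimately show ?thesis unfolding Let_def m_def[symmetric] by blast
qed

end
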